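(* Let $X$ be a CAT(0) space. Then $X$ is (Gromov) hyperbolic if and only if there is a uniform $E>0$ such that every curtain grid in $X$ is $E$-thin.
   Context: **Curtains.** Let $b:I\to X$ be a geodesic, $\pi_b$ the closest point projection to $b$, and $r$ a number with $[r-\frac12,r+\frac12]$ in the interior of $I$. The curtain dual to $b$ at $r$ is $h=h_{b,r}=\pi_b^{-1}(b([r-\frac12,r+\frac12]))$; its half spaces $h^-$ and $h^+$ are the preimages under $\pi_b$ of the parts of $b$ before $r-\frac12$ and after $r+\frac12$. A curtain $h$ separates $A,B\subset X$ if one of $A,B$ lies in $h^-$ and the other in $h^+$. A set $\{h_i\}$ of curtains is a chain if the $h_i$ are pairwise disjoint and $h_i$ separates $h_{i-1}$ from $h_{i+1}$ for all $i$. **Curtain grids.** Two chains of curtains $\mathcal{H}=\{h_1,\dots,h_n\}$ and $\mathcal{K}=\{k_1,\dots,k_m\}$ form a curtain grid $(\mathcal{H},\mathcal{K})$ if every curtain of $\mathcal{H}$ crosses (i.e. intersects) every curtain of $\mathcal{K}$. The grid is $E$-thin if $\min\{|\mathcal{H}|,|\mathcal{K}|\}\le E$. *)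

theory Defs
  imports "HOL-Analysis.Analysis"
begin

text \<open>
  A space is a type of class \<open>metric_space\<close>; a statement about \<open>TYPE('a)\<close> is a statement about
  the whole space.
\<close>

section \<open>Geodesics, CAT(0) spaces and hyperbolicity\<close>

text \<open>
  A geodesic is an isometric embedding of a closed, possibly unbounded, interval.  Closedness
  makes the image complete, so that closest points on it exist in every CAT(0) space,
  complete or not.
\<close>

definition geodesic :: "real set \<Rightarrow> (real \<Rightarrow> 'a::metric_space) \<Rightarrow> bool" where
  "geodesic I b \<longleftrightarrow>
     is_interval I \<and> closed I \<and> (\<forall>s\<in>I. \<forall>t\<in>I. dist (b s) (b t) = \<bar>s - t\<bar>)"

definition geodesic_segment :: "'a::metric_space \<Rightarrow> 'a \<Rightarrow> 'a set \<Rightarrow> bool" where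
  "geodesic_segment x y S \<longleftrightarrow>
     (\<exists>b. geodesic {0..dist x y} b \<and> b 0 = x \<and> b (dist x y) = y \<and> S = b ` {0..dist x y})"

definition geodesic_triangle ::
    "'a::metric_space \<Rightarrow> 'a \<Rightarrow> 'a \<Rightarrow> 'a set \<Rightarrow> 'a set \<Rightarrow> 'a set \<Rightarrow> bool" where
  "geodesic_triangle x y z A B C \<longleftrightarrow>
     geodesic_segment x y A \<and> geodesic_segment y z B \<and> geodesic_segment z x C"

definition geodesic_space :: "'a::metric_space itself \<Rightarrow> bool" where
  "geodesic_space _ \<longleftrightarrow> (\<forall>x y :: 'a. \<exists>S. geodesic_segment x y S)"

definition comparison_triangle ::
    "'a::metric_space \<Rightarrow> 'a \<Rightarrow> 'a \<Rightarrow> real^2 \<Rightarrow> real^2 \<Rightarrow> real^2 \<Rightarrow> bool" where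
  "comparison_triangle x y z x' y' z' \<longleftrightarrow>
     dist x' y' = dist x y \<and> dist y' z' = dist y z \<and> dist z' x' = dist z x"

text \<open>\<open>p'\<close> is the comparison point on the Euclidean side from \<open>x'\<close> to \<open>y'\<close> for the point \<open>p\<close> of
  the side \<open>S\<close> from \<open>x\<close> to \<open>y\<close>.\<close>

definition comparison_point ::
    "'a::metric_space \<Rightarrow> 'a set \<Rightarrow> real^2 \<Rightarrow> real^2 \<Rightarrow> 'a \<Rightarrow> real^2 \<Rightarrow> bool" where
  "comparison_point x S x' y' p p' \<longleftrightarrow>
     p \<in> S \<and> p' \<in> closed_segment x' y' \<and> dist x' p' = dist x p"

definition cat0_space :: "'a::metric_space itself \<Rightarrow> bool" where
  "cat0_space T \<longleftrightarrow> geodesic_space T \<and>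
     (\<forall>(x::'a) y z A B C x' y' z'.
        geodesic_triangle x y z A B C \<longrightarrow> comparison_triangle x y z x' y' z' \<longrightarrow>
        (let comparison = (\<lambda>p p'. comparison_point x A x' y' p p' \<or>
                                  comparison_point y B y' z' p p' \<or>
                                  comparison_point z C z' x' p p')
         in \<forall>p p' q q'. comparison p p' \<longrightarrow> comparison q q' \<longrightarrow> dist p q \<le> dist p' q'))"

text \<open>
  Hyperbolicity of a geodesic space is the slim triangles condition.  Quantifying over all vertex
  orders makes it enough to constrain the side \<open>A\<close>.
\<close>

definition Gromov_hyperbolic :: "'a::metric_space itself \<Rightarrow> bool" where
  "Gromov_hyperbolic T \<longleftrightarrow> geodesic_space T \<and>
     (\<exists>\<delta>\<ge>0. \<forall>(x::'a) y z A B C. geodesic_triangle x y z A B C \<longrightarrow>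
        (\<forall>p\<in>A. \<exists>q\<in>B \<union> C. dist p q \<le> \<delta>))"


section \<open>Curtains\<close>

text \<open>The library's \<^const>\<open>closest_point\<close> requires an inner product space.\<close>

definition nearest_point :: "'a::metric_space set \<Rightarrow> 'a \<Rightarrow> 'a" where
  "nearest_point S x = (SOME p. p \<in> S \<and> (\<forall>q\<in>S. dist x p \<le> dist x q))"

text \<open>
  Half spaces belong to the pair \<open>(b, r)\<close>, not to the underlying set of the curtain, so a curtain
  is represented by its dual geodesic (with its domain) and the parameter \<open>r\<close>.
\<close>

datatype 'a curtain_data = Dual (dom: "real set") (geod: "real \<Rightarrow> 'a") (centre: real)

definition is_curtain :: "'a::metric_space curtain_data \<Rightarrow> bool" where
  "is_curtain c \<longleftrightarrow> geodesic (dom c) (geod c) \<and>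
     {centre c - 1/2..centre c + 1/2} \<subseteq> interior (dom c)"

definition curtain_proj :: "'a::metric_space curtain_data \<Rightarrow> 'a \<Rightarrow> 'a" where
  "curtain_proj c = nearest_point (geod c ` dom c)"

definition curtain :: "'a::metric_space curtain_data \<Rightarrow> 'a set" where
  "curtain c = curtain_proj c -` (geod c ` {centre c - 1/2..centre c + 1/2})"

definition half_minus :: "'a::metric_space curtain_data \<Rightarrow> 'a set" where
  "half_minus c = curtain_proj c -` (geod c ` {t \<in> dom c. t < centre c - 1/2})"

definition half_plus :: "'a::metric_space curtain_data \<Rightarrow> 'a set" where
  "half_plus c = curtain_proj c -` (geod c ` {t \<in> dom c. centre c + 1/2 < t})"

definition separates :: "'a::metric_space curtain_data \<Rightarrow> 'a set \<Rightarrow> 'a set \<Rightarrow> bool" where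
  "separates c A B \<longleftrightarrow>
     (A \<subseteq> half_minus c \<and> B \<subseteq> half_plus c) \<or> (A \<subseteq> half_plus c \<and> B \<subseteq> half_minus c)"

definition curtain_chain :: "'a::metric_space curtain_data list \<Rightarrow> bool" where
  "curtain_chain H \<longleftrightarrow>
     (\<forall>c\<in>set H. is_curtain c) \<and>
     (\<forall>i<length H. \<forall>j<length H. i \<noteq> j \<longrightarrow> curtain (H ! i) \<inter> curtain (H ! j) = {}) \<and>
     (\<forall>i. 0 < i \<and> i + 1 < length H \<longrightarrow>
        separates (H ! i) (curtain (H ! (i - 1))) (curtain (H ! (i + 1))))"

definition curtain_grid ::
    "'a::metric_space curtain_data list \<Rightarrow> 'a curtain_data list \<Rightarrow> bool" where
  "curtain_grid H K \<longleftrightarrow> curtain_chain H \<and> curtain_chain K \<and>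
     (\<forall>h\<in>set H. \<forall>k\<in>set K. curtain h \<inter> curtain k \<noteq> {})"

definition thin_grid ::
    "real \<Rightarrow> 'a::metric_space curtain_data list \<Rightarrow> 'a curtain_data list \<Rightarrow> bool" where
  "thin_grid E H K \<longleftrightarrow>
     real (min (card (curtain ` set H)) (card (curtain ` set K))) \<le> E"

lemma centre_in_curtain:
  assumes "is_curtain c"
  shows "geod c (centre c) \<in> curtain c"
proof -
  let ?p = "geod c (centre c)" and ?S = "geod c ` dom c"
  have "centre c \<in> dom c"
    using assms interior_subset by (fastforce simp: is_curtain_def)
  then have p: "?p \<in> ?S" by blast
  have "nearest_point ?S ?p \<in> ?S \<and> (\<forall>q\<in>?S. dist ?p (nearest_point ?S ?p) \<le> dist ?p q)"
    unfolding nearest_point_def by (rule someI[of _ ?p]) (use p in simp)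
  then have "dist ?p (nearest_point ?S ?p) \<le> dist ?p ?p"
    using p by blast
  then have "curtain_proj c ?p = ?p"
    by (simp add: curtain_proj_def)
  then show ?thesis
    by (simp add: curtain_def)
qed

text \<open>In particular the cardinality of a chain, as a set of curtains, is the length of the list.\<close>

lemma card_curtain_chain:
  assumes "curtain_chain H"
  shows "card (curtain ` set H) = length H"
proof -
  have "distinct (map curtain H)"
    unfolding distinct_conv_nth
  proof (intro allI impI)
    fix i j assume ij: "i < length (map curtain H)" "j < length (map curtain H)" "i \<noteq> j"
    then have "curtain (H ! i) \<inter> curtain (H ! j) = {}"
      using assms by (simp add: curtain_chain_def)
    moreover have "curtain (H ! i) \<noteq> {}"
      using assms ij centre_in_curtain[of "H ! i"] by (auto simp: curtain_chain_def)
    ultimately show "map curtain H ! i \<noteq> map curtain H ! j"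
      using ij by auto
  qed
  then show ?thesis
    using distinct_card by fastforce
qed

end

theory Submission
  imports Defs
begin

text \<open>
  If triangles are slim, curtains are quasiconvex, and four points where the first and last curtains
  of the two chains cross span a quadrilateral with both pairs of opposite sides far apart as soon
  as both chains are long; a slim quadrilateral of this kind does not exist.

  Conversely, let \<open>q\<close> be the point of a geodesic closest to \<open>x\<close>, and let \<open>y\<close> be another point of
  that geodesic.  Unless \<open>[x, y]\<close> contains a point whose closest points on both \<open>[q, x]\<close> and
  \<open>[q, y]\<close> are near \<open>q\<close>, curtains dual to these two legs form a large grid.  Such a point gives
  \<open>d(x, y) \<ge> d(x, q) + d(q, y) - C\<close>.  Slim triangles follow: for \<open>p\<close> in \<open>[q, y]\<close> and \<open>w\<close> the point
  of \<open>[x, y]\<close> closest to \<open>p\<close>, add up the inequalities for \<open>(p, w, x)\<close>, \<open>(p, w, y)\<close> and \<open>(x, q, y)\<close>.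
\<close>

section \<open>Convexity in CAT(0) spaces\<close>

text \<open>Law of cosines: with \<open>x'\<close> at the origin and \<open>y'\<close> at
  \<open>(c, 0)\<close>, the third vertex \<open>(u, v)\<close> must satisfy
  \<open>2 * c * u = b^2 + c^2 - a^2\<close>. The triangle inequalities give
  \<open>|u| <= b\<close>, so a suitable \<open>v\<close> exists.\<close>

lemma comparison_triangle_exists:
  fixes x y z :: "'a::metric_space"
  shows "\<exists>x' y' z'. comparison_triangle x y z x' y' z'"
proof -
  define a b c where "a = dist y z" and "b = dist z x" and "c = dist x y"
  have tri: "a \<le> b + c" "b \<le> a + c" "c \<le> a + b" "0 \<le> a" "0 \<le> b" "0 \<le> c"
    unfolding a_def b_def c_def
    using dist_triangle[of y z x] dist_triangle[of z x y] dist_triangle[of x y z]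
    by (simp add: dist_commute)+
  \<comment> \<open>If \<open>c = 0\<close> then \<open>a = b\<close>, and any \<open>u\<close>
    between \<open>- b\<close> and \<open>b\<close> would do; the value \<open>b\<close> is
    chosen.\<close>
  define u where "u = (if c = 0 then b else (b\<^sup>2 + c\<^sup>2 - a\<^sup>2) / (2 * c))"
  have cu: "2 * c * u = b\<^sup>2 + c\<^sup>2 - a\<^sup>2"
    using tri by (auto simp: u_def)
  have "u\<^sup>2 \<le> b\<^sup>2"
  proof (cases "c = 0")
    case False
    have "\<bar>a\<bar> \<le> \<bar>b + c\<bar>" "\<bar>b - c\<bar> \<le> \<bar>a\<bar>"
      using tri by linarith+
    then have "a\<^sup>2 \<le> (b + c)\<^sup>2" "(b - c)\<^sup>2 \<le> a\<^sup>2"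
      by (simp add: abs_le_square_iff)+
    then have "2 * c * u \<le> 2 * c * b" "2 * c * (- b) \<le> 2 * c * u"
      unfolding cu by (simp add: power2_eq_square algebra_simps)+
    then have "\<bar>u\<bar> \<le> \<bar>b\<bar>"
      using False tri(5,6) by (subst (asm) (1 2) mult_le_cancel_left_pos; auto)
    then show ?thesis
      by (simp add: abs_le_square_iff)
  qed (simp add: u_def)
  define v where "v = sqrt (b\<^sup>2 - u\<^sup>2)"
  have v: "v\<^sup>2 = b\<^sup>2 - u\<^sup>2"
    using \<open>u\<^sup>2 \<le> b\<^sup>2\<close> by (simp add: v_def)
  have norm2: "norm (vector [p, q] :: real^2) = sqrt (p\<^sup>2 + q\<^sup>2)" for p q
    by (simp add: norm_vec_def L2_set_def sum_2)
  have diff2: "vector [p, q] - vector [p', q'] = (vector [p - p', q - q'] :: real^2)" for p q p' q' :: real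
    by (simp add: vec_eq_iff forall_2)
  have "(c - u)\<^sup>2 + v\<^sup>2 = a\<^sup>2"
    using cu v by (simp add: power2_eq_square algebra_simps)
  moreover have "u\<^sup>2 + v\<^sup>2 = b\<^sup>2"
    using v by simp
  ultimately have "comparison_triangle x y z (vector [0, 0]) (vector [c, 0]) (vector [u, v])"
    unfolding comparison_triangle_def dist_norm[where 'a = "real^2"] diff2 norm2
    using tri by (simp add: a_def[symmetric] b_def[symmetric] c_def[symmetric])
  then show ?thesis by blast
qed

text \<open>Stewart's theorem, the Euclidean equality behind the CN inequality.\<close>

lemma dist_convex_comb_sq:
  fixes x y z :: "'a::real_inner"
  shows "(dist z ((1 - l) *\<^sub>R x + l *\<^sub>R y))\<^sup>2 =
    (1 - l) * (dist z x)\<^sup>2 + l * (dist z y)\<^sup>2 - l * (1 - l) * (dist x y)\<^sup>2"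
  unfolding dist_norm power2_norm_eq_inner
  by (simp add: algebra_simps inner_commute power2_eq_square)

section \<open>Geodesics and geodesic segments\<close>

lemma geodesic_isometric:
  "geodesic I b \<Longrightarrow> s \<in> I \<Longrightarrow> t \<in> I \<Longrightarrow> dist (b s) (b t) = \<bar>s - t\<bar>"
  by (simp add: geodesic_def)

lemma geodesic_continuous_on: "geodesic I b \<Longrightarrow> continuous_on I b"
  by (rule continuous_onI[where f = b])
    (auto simp: geodesic_isometric dist_real_def intro: less_imp_le)

lemma geodesic_closed_segment_subset:
  assumes "geodesic I b" "s \<in> I" "t \<in> I"
  shows "closed_segment s t \<subseteq> I"
proof -
  have "convex I"
    using assms(1) by (intro is_interval_convex) (simp add: geodesic_def)
  then show ?thesis
    using assms(2,3) by (rule closed_segment_subset[rotated 2])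
qed

lemma geodesic_segmentE:
  assumes "geodesic_segment x y S"
  obtains b where "geodesic {0..dist x y} b" "b 0 = x" "b (dist x y) = y" "S = b ` {0..dist x y}"
  using assms unfolding geodesic_segment_def by blast

lemma geodesic_segment_subgeodesic:
  assumes "geodesic I b" "s \<in> I" "t \<in> I"
  shows "geodesic_segment (b s) (b t) (b ` closed_segment s t)"
proof -
  have d: "dist (b s) (b t) = \<bar>s - t\<bar>"
    using assms by (rule geodesic_isometric)
  \<comment> \<open>The direction of travel: the subsegment is traversed backwards if
    \<open>t < s\<close>.\<close>
  define e :: real where "e = (if s \<le> t then 1 else -1)"
  have e: "t = s + e * \<bar>s - t\<bar>" "e * e = 1" "\<bar>e\<bar> = 1"
    by (fastforce simp: e_def)+
  have img: "(\<lambda>r. s + e * r) ` {0..\<bar>s - t\<bar>} = closed_segment s t"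
  proof
    show "(\<lambda>r. s + e * r) ` {0..\<bar>s - t\<bar>} \<subseteq> closed_segment s t"
      by (auto simp: e_def closed_segment_eq_real_ivl)
    show "closed_segment s t \<subseteq> (\<lambda>r. s + e * r) ` {0..\<bar>s - t\<bar>}"
    proof
      fix r assume "r \<in> closed_segment s t"
      then have "r = s + e * (e * (r - s))" "e * (r - s) \<in> {0..\<bar>s - t\<bar>}"
        by (auto simp: e_def closed_segment_eq_real_ivl split: if_splits)
      then show "r \<in> (\<lambda>r. s + e * r) ` {0..\<bar>s - t\<bar>}" by blast
    qed
  qed
  have sub: "closed_segment s t \<subseteq> I"
    using assms by (rule geodesic_closed_segment_subset)
  have "geodesic {0..\<bar>s - t\<bar>} (\<lambda>r. b (s + e * r))"
    unfolding geodesic_def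
  proof (intro conjI ballI)
    fix r r' assume "r \<in> {0..\<bar>s - t\<bar>}" "r' \<in> {0..\<bar>s - t\<bar>}"
    then have "s + e * r \<in> I" "s + e * r' \<in> I" using sub img by blast+
    then have "dist (b (s + e * r)) (b (s + e * r')) = \<bar>e * (r - r')\<bar>"
      using assms(1) by (simp add: geodesic_isometric algebra_simps)
    then show "dist (b (s + e * r)) (b (s + e * r')) = \<bar>r - r'\<bar>"
      by (simp add: abs_mult e)
  qed (simp add: is_interval_cc)+
  then show ?thesis
    unfolding geodesic_segment_def d
    by (intro exI[of _ "\<lambda>r. b (s + e * r)"]) (simp add: e(1)[symmetric] img[symmetric] image_image)
qed

lemma geodesic_segment_commute:
  assumes "geodesic_segment x y S" shows "geodesic_segment y x S"
proof -
  obtain b where b: "geodesic {0..dist x y} b" "b 0 = x" "b (dist x y) = y" "S = b ` {0..dist x y}"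
    using assms by (rule geodesic_segmentE)
  have "geodesic_segment (b (dist x y)) (b 0) (b ` closed_segment (dist x y) 0)"
    by (rule geodesic_segment_subgeodesic[OF b(1)]; auto)
  then show ?thesis
    using b by (simp add: closed_segment_commute closed_segment_eq_real_ivl1)
qed

lemma geodesic_segment_endpoints:
  assumes "geodesic_segment x y S" shows "x \<in> S" "y \<in> S"
proof -
  obtain b where "b 0 = x" "b (dist x y) = y" "S = b ` {0..dist x y}"
    using assms by (rule geodesic_segmentE)
  then show "x \<in> S" "y \<in> S"
    by (metis atLeastAtMost_iff image_eqI order_refl zero_le_dist)+
qed

lemma geodesic_segment_between:
  assumes "geodesic_segment x y S" "p \<in> S"
  shows "dist x p + dist p y = dist x y"
proof -
  obtain b where b: "geodesic {0..dist x y} b" "b 0 = x" "b (dist x y) = y" "S = b ` {0..dist x y}"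
    using assms(1) by (rule geodesic_segmentE)
  then obtain t where t: "t \<in> {0..dist x y}" "p = b t"
    using assms(2) by blast
  have "dist (b 0) (b t) = t" "dist (b t) (b (dist x y)) = dist x y - t"
    using t by (fastforce simp: geodesic_isometric[OF b(1)])+
  then show ?thesis using b t by simp
qed

lemma geodesic_segment_connected:
  assumes "geodesic_segment x y S" shows "connected S"
  using assms unfolding geodesic_segment_def
  by (auto intro!: connected_continuous_image geodesic_continuous_on)

lemma cat0_geodesic_segment_exists:
  assumes "cat0_space TYPE('a::metric_space)"
  obtains S where "geodesic_segment (x::'a) y S"
  using assms unfolding cat0_space_def geodesic_space_def by blast

text \<open>The CN inequality of Bruhat and Tits: compare the distance from a point of a side to the
  opposite vertex with the Euclidean one, which Stewart's theorem computes.\<close>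

lemma cat0_CN:
  fixes b :: "real \<Rightarrow> 'a::metric_space"
  assumes cat0: "cat0_space TYPE('a)"
    and b: "geodesic I b" "s \<in> I" "t \<in> I" and l: "0 \<le> l" "l \<le> 1"
  shows "(dist z (b ((1 - l) * s + l * t)))\<^sup>2 \<le>
    (1 - l) * (dist z (b s))\<^sup>2 + l * (dist z (b t))\<^sup>2 - l * (1 - l) * (s - t)\<^sup>2"
proof -
  let ?x = "b s" and ?y = "b t" and ?p = "b ((1 - l) * s + l * t)"
  let ?A = "b ` closed_segment s t"
  obtain B C where BC: "geodesic_segment ?y z B" "geodesic_segment z ?x C"
    using cat0_geodesic_segment_exists[OF cat0] by metis
  have tri: "geodesic_triangle ?x ?y z ?A B C"
    using geodesic_segment_subgeodesic[OF b] BC by (simp add: geodesic_triangle_def)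
  obtain x' y' z' where cmp: "comparison_triangle ?x ?y z x' y' z'"
    using comparison_triangle_exists by blast
  then have d': "dist x' y' = \<bar>s - t\<bar>" "dist z' y' = dist z ?y" "dist z' x' = dist z ?x"
    using geodesic_isometric[OF b] by (fastforce simp: comparison_triangle_def dist_commute)+
  let ?p' = "(1 - l) *\<^sub>R x' + l *\<^sub>R y'"
  have mid: "(1 - l) * s + l * t \<in> closed_segment s t"
    unfolding in_segment using l by (intro exI[of _ l]) simp
  then have "(1 - l) * s + l * t \<in> I"
    using geodesic_closed_segment_subset[OF b] by blast
  then have "dist ?x ?p = \<bar>l * (s - t)\<bar>"
    using b by (simp add: geodesic_isometric algebra_simps)
  moreover have "x' - ?p' = l *\<^sub>R (x' - y')"
    by (simp add: algebra_simps)
  then have "dist x' ?p' = l * dist x' y'"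
    using l by (simp add: dist_norm)
  ultimately have "comparison_point ?x ?A x' y' ?p ?p'"
    using mid l d'(1) by (auto simp: comparison_point_def in_segment abs_mult)
  moreover have "comparison_point z C z' x' z z'"
    using geodesic_segment_endpoints[OF BC(2)] by (simp add: comparison_point_def)
  ultimately have "dist z ?p \<le> dist z' ?p'"
    using cat0 tri cmp unfolding cat0_space_def Let_def by blast
  then have "(dist z ?p)\<^sup>2 \<le> (dist z' ?p')\<^sup>2"
    by (simp add: power_mono)
  then show ?thesis
    by (simp add: dist_convex_comb_sq d')
qed

text \<open>CN bounds the distances of \<open>y\<close> and \<open>w\<close> to the midpoint
  \<open>m\<close> of \<open>[x, z]\<close>; combine this with
  \<open>(p + q)^2 <= 2 * p^2 + 2 * q^2\<close>.\<close>

lemma cat0_quadrilateral: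
  fixes x y z w :: "'a::metric_space"
  assumes cat0: "cat0_space TYPE('a)"
  shows "(dist x z)\<^sup>2 + (dist y w)\<^sup>2 \<le> (dist x y)\<^sup>2 + (dist y z)\<^sup>2 + (dist z w)\<^sup>2 + (dist w x)\<^sup>2"
proof -
  obtain S where "geodesic_segment x z S"
    by (rule cat0_geodesic_segment_exists[OF cat0])
  then obtain b where b: "geodesic {0..dist x z} b" "b 0 = x" "b (dist x z) = z"
    by (rule geodesic_segmentE)
  define m where "m = b ((1 - 1/2) * 0 + 1/2 * dist x z)"
  have CN: "(dist v m)\<^sup>2 \<le> (dist v x)\<^sup>2 / 2 + (dist v z)\<^sup>2 / 2 - (dist x z)\<^sup>2 / 4" for v
    using cat0_CN[OF cat0 b(1), of 0 "dist x z" "1/2" v] b unfolding m_def by simp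
  have "(dist y w)\<^sup>2 \<le> (dist y m + dist w m)\<^sup>2"
    by (intro power_mono dist_triangle2) simp
  also have "\<dots> \<le> 2 * (dist y m)\<^sup>2 + 2 * (dist w m)\<^sup>2"
    using sum_squares_bound[of "dist y m" "dist w m"] by (simp add: power2_sum)
  finally show ?thesis
    using CN[of y] CN[of w] by (simp add: dist_commute)
qed

section \<open>Feet of perpendiculars\<close>

text \<open>Intermediate values are available for the real parameter of the closest point, unlike for
  the closest point itself.\<close>

definition is_foot :: "real set \<Rightarrow> (real \<Rightarrow> 'a::metric_space) \<Rightarrow> 'a \<Rightarrow> real \<Rightarrow> bool" where
  "is_foot I b x t \<longleftrightarrow> t \<in> I \<and> (\<forall>s\<in>I. dist x (b t) \<le> dist x (b s))"

definition foot :: "real set \<Rightarrow> (real \<Rightarrow> 'a::metric_space) \<Rightarrow> 'a \<Rightarrow> real" where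
  "foot I b x = (SOME t. is_foot I b x t)"

text \<open>The interval may be unbounded. With \<open>R\<close> the distance from \<open>x\<close>
  to \<open>b t0\<close>, parameters further than \<open>2 * R\<close> from \<open>t0\<close> give
  points further than \<open>R\<close> from \<open>x\<close>, so a minimum over a compact part is
  global.\<close>

lemma is_foot_exists:
  assumes b: "geodesic I b" and "I \<noteq> {}"
  shows "\<exists>t. is_foot I b x t"
proof -
  obtain t0 where t0: "t0 \<in> I" using assms(2) by blast
  define R where "R = dist x (b t0)"
  let ?J = "I \<inter> {t0 - 2 * R..t0 + 2 * R}"
  have "compact ?J"
    using b by (intro closed_Int_compact; auto simp: geodesic_def)
  moreover have "t0 \<in> ?J"
    using t0 by (simp add: R_def)
  moreover have "continuous_on ?J (\<lambda>t. dist x (b t))"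
    by (intro continuous_intros continuous_on_subset[OF geodesic_continuous_on[OF b]]; auto)
  ultimately obtain t where t: "t \<in> ?J" "\<And>s. s \<in> ?J \<Longrightarrow> dist x (b t) \<le> dist x (b s)"
    using continuous_attains_inf[of ?J "\<lambda>t. dist x (b t)"] by blast
  have "dist x (b t) \<le> dist x (b s)" if "s \<in> I" for s
  proof (cases "s \<in> ?J")
    case False
    have "dist (b s) (b t0) = \<bar>s - t0\<bar>"
      using that t0 b by (simp add: geodesic_isometric)
    moreover have "\<bar>s - t0\<bar> > 2 * R"
      using that False by (auto simp: abs_le_iff)
    ultimately have "dist x (b s) > R"
      using dist_triangle3[of "b s" "b t0" x] by (simp add: R_def dist_commute)
    moreover have "dist x (b t) \<le> R"
      using t(2)[OF \<open>t0 \<in> ?J\<close>] by (simp add: R_def)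
    ultimately show ?thesis by simp
  qed (rule t(2))
  then show ?thesis
    using t(1) by (auto simp: is_foot_def)
qed

lemma is_foot_foot: "geodesic I b \<Longrightarrow> I \<noteq> {} \<Longrightarrow> is_foot I b x (foot I b x)"
  unfolding foot_def by (rule someI_ex) (rule is_foot_exists)

lemma foot_in: "geodesic I b \<Longrightarrow> I \<noteq> {} \<Longrightarrow> foot I b x \<in> I"
  using is_foot_foot by (auto simp: is_foot_def)

lemma is_foot_geodesic: "t \<in> I \<Longrightarrow> is_foot I b (b t) t"
  by (simp add: is_foot_def)

text \<open>A point closer to \<open>z\<close> would give a shortcut from \<open>x\<close> through
  \<open>z\<close>. Hence feet are constant along the perpendicular from \<open>x\<close>, which is
  how points with prescribed feet are found later.\<close>

lemma is_foot_between:
  assumes "is_foot I b x t" "dist x z + dist z (b t) = dist x (b t)"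
  shows "is_foot I b z t"
  unfolding is_foot_def
proof (intro conjI ballI)
  fix s assume "s \<in> I"
  then have "dist x (b t) \<le> dist x (b s)" using assms by (simp add: is_foot_def)
  then show "dist z (b t) \<le> dist z (b s)"
    using assms(2) dist_triangle[of x "b s" z] by linarith
qed (use assms in \<open>simp add: is_foot_def\<close>)

text \<open>The angle at the foot is not acute. Apply CN to the point a fraction \<open>l\<close> of
  the way from the foot to \<open>b s\<close>, which is no closer to \<open>x\<close> than the foot;
  divide by \<open>l\<close> and let \<open>l\<close> tend to 0.\<close>

lemma cat0_pythagoras:
  fixes b :: "real \<Rightarrow> 'a::metric_space"
  assumes cat0: "cat0_space TYPE('a)" and b: "geodesic I b" and t: "is_foot I b x t" and s: "s \<in> I"
  shows "(dist x (b t))\<^sup>2 + (t - s)\<^sup>2 \<le> (dist x (b s))\<^sup>2"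
proof -
  have tI: "t \<in> I" using t by (simp add: is_foot_def)
  have *: "(dist x (b t))\<^sup>2 + (1 - l) * (t - s)\<^sup>2 \<le> (dist x (b s))\<^sup>2" if l: "0 < l" "l \<le> 1" for l
  proof -
    have "(1 - l) * t + l * s \<in> closed_segment t s"
      unfolding in_segment using l by (intro exI[of _ l]) simp
    then have "(1 - l) * t + l * s \<in> I"
      using geodesic_closed_segment_subset[OF b tI s] by blast
    then have "(dist x (b t))\<^sup>2 \<le> (dist x (b ((1 - l) * t + l * s)))\<^sup>2"
      using t by (auto simp: is_foot_def intro: power_mono)
    also have "\<dots> \<le> (1 - l) * (dist x (b t))\<^sup>2 + l * (dist x (b s))\<^sup>2 - l * (1 - l) * (t - s)\<^sup>2"
      using l by (intro cat0_CN[OF cat0 b tI s]; auto)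
    finally have "l * ((dist x (b t))\<^sup>2 + (1 - l) * (t - s)\<^sup>2) \<le> l * (dist x (b s))\<^sup>2"
      by (simp add: algebra_simps)
    then show ?thesis using l by simp
  qed
  show ?thesis
  proof (rule tendsto_upperbound)
    show "((\<lambda>l. (dist x (b t))\<^sup>2 + (1 - l) * (t - s)\<^sup>2) \<longlongrightarrow>
        (dist x (b t))\<^sup>2 + (t - s)\<^sup>2) (at_right 0)"
      by (rule tendsto_eq_intros refl | simp)+
    show "\<forall>\<^sub>F l in at_right 0. (dist x (b t))\<^sup>2 + (1 - l) * (t - s)\<^sup>2 \<le> (dist x (b s))\<^sup>2"
      using * by (auto simp: eventually_at_right_field intro!: exI[of _ 1])
  qed simp
qed

text \<open>Add the Pythagorean inequalities for \<open>x\<close> and \<open>y\<close>, and bound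
  the sum of squares of the diagonals from \<open>x\<close> to \<open>b s\<close> and from
  \<open>y\<close> to \<open>b t\<close> by the quadrilateral inequality.\<close>

lemma cat0_is_foot_lipschitz:
  fixes b :: "real \<Rightarrow> 'a::metric_space"
  assumes cat0: "cat0_space TYPE('a)" and b: "geodesic I b"
    and t: "is_foot I b x t" and s: "is_foot I b y s"
  shows "\<bar>t - s\<bar> \<le> dist x y"
proof -
  have I: "t \<in> I" "s \<in> I" using t s by (fastforce simp: is_foot_def)+
  have "(t - s)\<^sup>2 = (s - t)\<^sup>2" by (simp add: power2_commute)
  then have "(t - s)\<^sup>2 \<le> (dist x y)\<^sup>2"
    using cat0_pythagoras[OF cat0 b t I(2)] cat0_pythagoras[OF cat0 b s I(1)]
      cat0_quadrilateral[OF cat0, of x "b s" y "b t"] cat0_quadrilateral[OF cat0, of x y "b t" "b s"]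
      geodesic_isometric[OF b I]
    by (simp add: dist_commute)
  then show ?thesis
    by (simp add: abs_le_square_iff[symmetric])
qed

text \<open>Uniqueness of the foot is the Lipschitz bound at distance 0.\<close>

lemma cat0_foot_eqI:
  fixes b :: "real \<Rightarrow> 'a::metric_space"
  assumes "cat0_space TYPE('a)" "geodesic I b" "is_foot I b x t"
  shows "foot I b x = t"
proof -
  have "is_foot I b x (foot I b x)"
    unfolding foot_def by (rule someI) (rule assms(3))
  then show ?thesis
    using cat0_is_foot_lipschitz[OF assms(1,2) _ assms(3)] by fastforce
qed

lemma cat0_foot_lipschitz:
  fixes b :: "real \<Rightarrow> 'a::metric_space"
  assumes "cat0_space TYPE('a)" "geodesic I b" "I \<noteq> {}"
  shows "\<bar>foot I b x - foot I b y\<bar> \<le> dist x y"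
  using assms is_foot_foot cat0_is_foot_lipschitz by blast

lemma cat0_continuous_on_foot:
  fixes b :: "real \<Rightarrow> 'a::metric_space"
  assumes "cat0_space TYPE('a)" "geodesic I b" "I \<noteq> {}"
  shows "continuous_on A (foot I b)"
proof (rule continuous_onI)
  fix x e assume "x \<in> A" "(0::real) < e"
  then show "\<exists>d>0. \<forall>x'\<in>A. dist x' x < d \<longrightarrow> dist (foot I b x') (foot I b x) \<le> e"
    using cat0_foot_lipschitz[OF assms, of _ x]
    by (intro exI[of _ e]; auto simp: dist_real_def intro: order_trans[OF _ less_imp_le])
qed

text \<open>Uniqueness of feet makes the two choices agree, one of a point and one of a
  parameter.\<close>

lemma cat0_nearest_point:
  fixes b :: "real \<Rightarrow> 'a::metric_space"
  assumes cat0: "cat0_space TYPE('a)" and b: "geodesic I b" and "I \<noteq> {}"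
  shows "nearest_point (b ` I) x = b (foot I b x)"
proof -
  have "is_foot I b x (foot I b x)"
    using assms by (intro is_foot_foot)
  then have "b (foot I b x) \<in> b ` I \<and> (\<forall>q\<in>b ` I. dist x (b (foot I b x)) \<le> dist x q)"
    by (auto simp: is_foot_def)
  then have "nearest_point (b ` I) x \<in> b ` I \<and>
      (\<forall>q\<in>b ` I. dist x (nearest_point (b ` I) x) \<le> dist x q)"
    unfolding nearest_point_def by (rule someI)
  then obtain t where "nearest_point (b ` I) x = b t" "is_foot I b x t"
    by (auto simp: is_foot_def)
  then show ?thesis
    using cat0_foot_eqI[OF cat0 b] by metis
qed

lemma cat0_connected_foot_vimage:
  fixes b :: "real \<Rightarrow> 'a::metric_space"
  assumes cat0: "cat0_space TYPE('a)" and b: "geodesic I b"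
    and J: "connected J" "J \<noteq> {}" "J \<subseteq> I"
  shows "connected {x. foot I b x \<in> J}"
proof -
  have "\<forall>x. \<exists>S. geodesic_segment x (b (foot I b x)) S"
    using cat0_geodesic_segment_exists[OF cat0] by metis
  then obtain S where S: "\<And>x. geodesic_segment x (b (foot I b x)) (S x)" by metis
  have ft: "is_foot I b x (foot I b x)" for x
    using b J by (intro is_foot_foot; auto)
  have foot_S: "foot I b z = foot I b x" if "z \<in> S x" for x z
    using geodesic_segment_between[OF S that] is_foot_between[OF ft] cat0_foot_eqI[OF cat0 b] by blast
  have foot_b: "foot I b (b t) = t" if "t \<in> J" for t
    using that J by (intro cat0_foot_eqI[OF cat0 b] is_foot_geodesic; auto)
  have "{x. foot I b x \<in> J} = (\<Union>x\<in>{x. foot I b x \<in> J}. S x \<union> b ` J)"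
  proof (intro set_eqI iffI)
    fix z assume "z \<in> {x. foot I b x \<in> J}"
    then show "z \<in> (\<Union>x\<in>{x. foot I b x \<in> J}. S x \<union> b ` J)"
      using geodesic_segment_endpoints(1)[OF S] by blast
  next
    fix z assume "z \<in> (\<Union>x\<in>{x. foot I b x \<in> J}. S x \<union> b ` J)"
    then obtain x where x: "foot I b x \<in> J" "z \<in> S x \<or> z \<in> b ` J" by blast
    then show "z \<in> {x. foot I b x \<in> J}"
      using foot_S foot_b by auto
  qed
  also have "connected \<dots>"
  proof (rule connected_Union)
    show "connected s" if "s \<in> (\<lambda>x. S x \<union> b ` J) ` {x. foot I b x \<in> J}" for s
    proof -
      obtain x where x: "s = S x \<union> b ` J" "foot I b x \<in> J" using \<open>s \<in> _\<close> by auto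
      have "connected (b ` J)"
        using geodesic_continuous_on[OF b] J by (auto intro: connected_continuous_image continuous_on_subset)
      then show ?thesis
        unfolding x(1) using geodesic_segment_endpoints(2)[OF S] x(2)
        by (intro connected_Un geodesic_segment_connected[OF S]) blast+
    qed
    obtain t where "t \<in> J" using J by blast
    then show "\<Inter> ((\<lambda>x. S x \<union> b ` J) ` {x. foot I b x \<in> J}) \<noteq> {}"
      by auto
  qed
  finally show ?thesis .
qed

lemma connected_real_ivt:
  fixes f :: "'a::topological_space \<Rightarrow> real"
  assumes "connected S" "continuous_on S f" "x \<in> S" "y \<in> S" "f x \<le> r" "r \<le> f y"
  obtains z where "z \<in> S" "f z = r"
proof -
  have "{f x..f y} \<subseteq> f ` S"
    using assms connected_continuous_image by (intro connected_contains_Icc) blast+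
  then have "r \<in> f ` S" using assms by auto
  then show ?thesis using that by blast
qed

section \<open>Cutting segments and closest points on them\<close>

lemma geodesic_segment_subsegment:
  assumes S: "geodesic_segment x y S" and q: "q \<in> S"
  obtains T where "T \<subseteq> S" "geodesic_segment q y T"
proof -
  obtain b where b: "geodesic {0..dist x y} b" "b (dist x y) = y" "S = b ` {0..dist x y}"
    using S by (rule geodesic_segmentE)
  then obtain t where t: "t \<in> {0..dist x y}" "q = b t"
    using q by blast
  have "closed_segment t (dist x y) \<subseteq> {0..dist x y}"
    by (rule geodesic_closed_segment_subset[OF b(1) t(1)]) simp
  moreover have "geodesic_segment q y (b ` closed_segment t (dist x y))"
    using geodesic_segment_subgeodesic[OF b(1) t(1), of "dist x y"] b(2) t(2) by simp
  ultimately show ?thesis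
    by (intro that[of "b ` closed_segment t (dist x y)"]; simp add: b(3) image_mono)
qed

text \<open>When \<open>q\<close> is the foot of the opposite vertex, this decides which half of the
  side contains \<open>p\<close>.\<close>

lemma geodesic_segment_trichotomy:
  assumes S: "geodesic_segment x y S" and "p \<in> S" "q \<in> S"
  shows "dist q p + dist p x = dist q x \<or> dist q p + dist p y = dist q y"
proof -
  obtain b where b: "geodesic {0..dist x y} b" "b 0 = x" "b (dist x y) = y" "S = b ` {0..dist x y}"
    using S by (rule geodesic_segmentE)
  then obtain s t where st: "s \<in> {0..dist x y}" "p = b s" "t \<in> {0..dist x y}" "q = b t"
    using assms(2,3) by blast
  have "dist q p = \<bar>t - s\<bar>"
    using st by (simp add: geodesic_isometric[OF b(1)])
  moreover have "dist (b r) x = r" "dist (b r) y = dist x y - r" if "r \<in> {0..dist x y}" for r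
    using that geodesic_isometric[OF b(1) that, of 0] geodesic_isometric[OF b(1) that, of "dist x y"]
    by (simp add: b(2,3))+
  ultimately show ?thesis
    using st by fastforce
qed

lemma nearest_on_geodesic_segment:
  assumes "geodesic_segment x y S"
  obtains q where "q \<in> S" "\<And>p. p \<in> S \<Longrightarrow> dist z q \<le> dist z p"
proof -
  obtain b where b: "geodesic {0..dist x y} b" "S = b ` {0..dist x y}"
    using assms by (rule geodesic_segmentE)
  obtain t where "is_foot {0..dist x y} b z t"
    using is_foot_exists[OF b(1)] by fastforce
  then show ?thesis
    using that[of "b t"] b by (auto simp: is_foot_def)
qed

section \<open>Curtains\<close>

text \<open>The coordinate of the projection with origin at the centre. The sign \<open>e\<close> is
  an orientation, so that one argument covers both half spaces.\<close>

definition signed_foot :: "real \<Rightarrow> 'a::metric_space curtain_data \<Rightarrow> 'a \<Rightarrow> real" where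
  "signed_foot e k x = e * (foot (dom k) (geod k) x - centre k)"

lemma is_curtain_geodesic: "is_curtain k \<Longrightarrow> geodesic (dom k) (geod k)"
  by (simp add: is_curtain_def)

lemma is_curtain_interval:
  assumes "is_curtain k" shows "{centre k - 1/2..centre k + 1/2} \<subseteq> dom k"
  using assms interior_subset[of "dom k"] by (auto simp: is_curtain_def)

lemma is_curtain_dom: "is_curtain k \<Longrightarrow> centre k \<in> dom k"
  using is_curtain_interval by fastforce

text \<open>A geodesic is injective, so conditions on the projected point become conditions on its
  parameter.\<close>

lemma cat0_curtain_proj_in_image_iff:
  fixes k :: "'a::metric_space curtain_data"
  assumes cat0: "cat0_space TYPE('a)" and k: "is_curtain k" and J: "J \<subseteq> dom k"
  shows "curtain_proj k x \<in> geod k ` J \<longleftrightarrow> foot (dom k) (geod k) x \<in> J"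
proof -
  have g: "geodesic (dom k) (geod k)" "dom k \<noteq> {}"
    using is_curtain_geodesic[OF k] is_curtain_dom[OF k] by fastforce+
  have "inj_on (geod k) (dom k)"
    by (rule inj_onI) (metis abs_eq_0 dist_self g(1) geodesic_isometric right_minus_eq)
  then show ?thesis
    using inj_on_image_mem_iff[OF _ foot_in[OF g] J]
    by (simp add: curtain_proj_def cat0_nearest_point[OF cat0 g])
qed

lemma cat0_curtain_iff:
  fixes k :: "'a::metric_space curtain_data"
  assumes cat0: "cat0_space TYPE('a)" and k: "is_curtain k" and e: "\<bar>e\<bar> = 1"
  shows "x \<in> curtain k \<longleftrightarrow> \<bar>signed_foot e k x\<bar> \<le> 1/2"
proof -
  have "\<bar>signed_foot e k x\<bar> = \<bar>foot (dom k) (geod k) x - centre k\<bar>"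
    using e by (simp add: signed_foot_def abs_mult)
  then show ?thesis
    unfolding curtain_def vimage_eq cat0_curtain_proj_in_image_iff[OF cat0 k is_curtain_interval[OF k]]
      atLeastAtMost_iff
    by arith
qed

lemma cat0_half_minus_iff:
  fixes k :: "'a::metric_space curtain_data"
  assumes cat0: "cat0_space TYPE('a)" and k: "is_curtain k"
  shows "x \<in> half_minus k \<longleftrightarrow> signed_foot 1 k x < - 1/2"
  using cat0_curtain_proj_in_image_iff[OF cat0 k, of "{t \<in> dom k. t < centre k - 1/2}" x]
    foot_in[OF is_curtain_geodesic[OF k], of x] is_curtain_dom[OF k]
  by (auto simp: half_minus_def signed_foot_def)

lemma cat0_half_plus_iff:
  fixes k :: "'a::metric_space curtain_data"
  assumes cat0: "cat0_space TYPE('a)" and k: "is_curtain k"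
  shows "x \<in> half_plus k \<longleftrightarrow> 1/2 < signed_foot 1 k x"
  using cat0_curtain_proj_in_image_iff[OF cat0 k, of "{t \<in> dom k. centre k + 1/2 < t}" x]
    foot_in[OF is_curtain_geodesic[OF k], of x] is_curtain_dom[OF k]
  by (auto simp: half_plus_def signed_foot_def)

text \<open>The orientation absorbs the two cases of \<open>separates\<close>.\<close>

lemma cat0_separatesE:
  fixes k :: "'a::metric_space curtain_data"
  assumes cat0: "cat0_space TYPE('a)" and k: "is_curtain k" and "separates k A B"
  obtains e where "\<bar>e\<bar> = 1" "\<And>x. x \<in> A \<Longrightarrow> signed_foot e k x < - 1/2"
    "\<And>x. x \<in> B \<Longrightarrow> 1/2 < signed_foot e k x"
proof -
  have neg: "signed_foot (- 1) k x = - signed_foot 1 k x" for x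
    by (simp add: signed_foot_def)
  from \<open>separates k A B\<close> consider
    "A \<subseteq> half_minus k \<and> B \<subseteq> half_plus k" | "A \<subseteq> half_plus k \<and> B \<subseteq> half_minus k"
    by (auto simp: separates_def)
  then show ?thesis
  proof cases
    case 1
    then show ?thesis
      using cat0_half_minus_iff[OF cat0 k] cat0_half_plus_iff[OF cat0 k]
      by (intro that[of 1]; auto)
  next
    case 2
    then have "signed_foot (- 1) k x < - 1/2" if "x \<in> A" for x
      using that cat0_half_plus_iff[OF cat0 k, of x] neg[of x] by auto
    moreover have "1/2 < signed_foot (- 1) k x" if "x \<in> B" for x
      using 2 that cat0_half_minus_iff[OF cat0 k, of x] neg[of x] by auto
    ultimately show ?thesis
      by (intro that[of "- 1"]) simp
  qed
qed

section \<open>Continuity and connectedness of curtains and half spaces\<close>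

lemma cat0_signed_foot_lipschitz:
  fixes k :: "'a::metric_space curtain_data"
  assumes cat0: "cat0_space TYPE('a)" and k: "is_curtain k" and e: "\<bar>e\<bar> = 1"
  shows "\<bar>signed_foot e k x - signed_foot e k y\<bar> \<le> dist x y"
  using cat0_foot_lipschitz[OF cat0 is_curtain_geodesic[OF k], of x y] is_curtain_dom[OF k] e
  by (auto simp: signed_foot_def right_diff_distrib[symmetric] abs_mult)

lemma cat0_continuous_on_signed_foot:
  fixes k :: "'a::metric_space curtain_data"
  assumes cat0: "cat0_space TYPE('a)" and k: "is_curtain k"
  shows "continuous_on A (signed_foot e k)"
  unfolding signed_foot_def
  using is_curtain_dom[OF k]
  by (intro continuous_intros cat0_continuous_on_foot[OF cat0 is_curtain_geodesic[OF k]]; auto)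

lemma cat0_connected_curtain:
  fixes k :: "'a::metric_space curtain_data"
  assumes cat0: "cat0_space TYPE('a)" and k: "is_curtain k"
  shows "connected (curtain k)"
proof -
  have "curtain k = {x. foot (dom k) (geod k) x \<in> {centre k - 1/2..centre k + 1/2}}"
    using cat0_curtain_proj_in_image_iff[OF cat0 k is_curtain_interval[OF k]]
    by (auto simp: curtain_def)
  then show ?thesis
    using cat0_connected_foot_vimage[OF cat0 is_curtain_geodesic[OF k] _ _ is_curtain_interval[OF k]]
    by simp
qed

text \<open>The condition cuts an interval out of the domain, and \<open>0 \<le> a\<close> puts the
  centre into it. For \<open>a = 1/2\<close> the set is a half space together with its
  curtain.\<close>

lemma cat0_connected_signed_foot_le:
  fixes k :: "'a::metric_space curtain_data"
  assumes cat0: "cat0_space TYPE('a)" and k: "is_curtain k" and e: "\<bar>e\<bar> = 1" and "0 \<le> a"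
  shows "connected {x. signed_foot e k x \<le> a}"
proof -
  have g: "geodesic (dom k) (geod k)" "dom k \<noteq> {}"
    using is_curtain_geodesic[OF k] is_curtain_dom[OF k] by fastforce+
  let ?J = "dom k \<inter> {t. e * (t - centre k) \<le> a}"
  have "{t. e * (t - centre k) \<le> a} = {..centre k + a} \<or> {t. e * (t - centre k) \<le> a} = {centre k - a..}"
    using e by (auto simp: abs_if split: if_splits)
  then have "is_interval {t. e * (t - centre k) \<le> a}"
    using is_interval_ic is_interval_ci by metis
  then have "is_interval ?J"
    using g(1) by (intro is_interval_Int; auto simp: geodesic_def)
  moreover have "centre k \<in> ?J"
    using is_curtain_dom[OF k] \<open>0 \<le> a\<close> by simp
  ultimately have "connected {x. foot (dom k) (geod k) x \<in> ?J}"
    by (intro cat0_connected_foot_vimage[OF cat0 g(1)]; auto simp: is_interval_connected_1)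
  then show ?thesis
    using foot_in[OF g] by (simp add: signed_foot_def)
qed

text \<open>Changing sides would force the coordinate through 0, that is, through the middle of the
  curtain.\<close>

lemma cat0_connected_disjoint_curtain_side:
  fixes k :: "'a::metric_space curtain_data"
  assumes cat0: "cat0_space TYPE('a)" and k: "is_curtain k" and e: "\<bar>e\<bar> = 1"
    and S: "connected S" "S \<inter> curtain k = {}"
    and xy: "x \<in> S" "y \<in> S" and x: "signed_foot e k x \<le> 1/2"
  shows "signed_foot e k y < - 1/2"
proof (rule ccontr)
  assume y: "\<not> signed_foot e k y < - 1/2"
  have avoid: "\<bar>signed_foot e k z\<bar> > 1/2" if "z \<in> S" for z
    using S(2) that cat0_curtain_iff[OF cat0 k e, of z] by force
  then have "signed_foot e k x \<le> 0" "0 \<le> signed_foot e k y"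
    using x y avoid[OF xy(1)] avoid[OF xy(2)] by fastforce+
  then obtain z where "z \<in> S" "signed_foot e k z = 0"
    using connected_real_ivt[OF S(1) cat0_continuous_on_signed_foot[OF cat0 k] xy] by metis
  then show False using avoid by fastforce
qed

section \<open>Hyperbolic spaces have thin grids\<close>

text \<open>The half spaces \<open>signed_foot e (H ! i) \<le> 1/2\<close> are nested: each is connected and misses
  the next curtain.\<close>

lemma cat0_curtain_chain_half_space:
  fixes H :: "'a::metric_space curtain_data list"
  assumes cat0: "cat0_space TYPE('a)" and H: "curtain_chain H" and i: "i + 1 < length H"
  shows "\<exists>e. \<bar>e\<bar> = 1 \<and> (\<forall>y\<in>curtain (H ! (i + 1)). 1/2 < signed_foot e (H ! i) y) \<and>
    (\<forall>x\<in>curtain (H ! 0). signed_foot e (H ! i) x \<le> 1/2 \<and>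
      (\<forall>y. 1/2 < signed_foot e (H ! i) y \<longrightarrow> real i \<le> dist x y))"
  using i
proof (induction i)
  have cur: "is_curtain (H ! i)" if "i < length H" for i
    using H that by (simp add: curtain_chain_def)
  have disj: "curtain (H ! i) \<inter> curtain (H ! j) = {}" if "i < length H" "j < length H" "i \<noteq> j" for i j
    using H that by (simp add: curtain_chain_def)
  {
    case 0
    then have "0 < length H" "1 < length H" by linarith+
    then have k: "is_curtain (H ! 0)" "is_curtain (H ! 1)" "curtain (H ! 1) \<inter> curtain (H ! 0) = {}"
      using cur[of 0] cur[of 1] disj[of 1 0] by blast+
    \<comment> \<open>Separation says nothing about the first curtain, so one point of the second
      fixes the side and connectedness carries the rest along. This point is on the negative side
      for \<open>e\<close>; the final witness is therefore \<open>- e\<close>.\<close>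
    obtain z where z: "z \<in> curtain (H ! 1)" using centre_in_curtain[OF k(2)] by blast
    then have "\<bar>signed_foot 1 (H ! 0) z\<bar> > 1/2"
      using k(3) cat0_curtain_iff[OF cat0 k(1), of 1 z] by force
    moreover have "signed_foot (- 1) (H ! 0) z = - signed_foot 1 (H ! 0) z"
      by (simp add: signed_foot_def)
    ultimately have "signed_foot 1 (H ! 0) z < - 1/2 \<or> signed_foot (- 1) (H ! 0) z < - 1/2"
      by linarith
    then obtain e :: real where e: "\<bar>e\<bar> = 1" "signed_foot e (H ! 0) z < - 1/2"
      by (metis abs_1 abs_minus_cancel)
    have "signed_foot e (H ! 0) y < - 1/2" if "y \<in> curtain (H ! 1)" for y
      using cat0_connected_disjoint_curtain_side[OF cat0 k(1) e(1) cat0_connected_curtain[OF cat0 k(2)] k(3) z that]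
        e(2) by simp
    moreover have "signed_foot (- e) (H ! 0) y = - signed_foot e (H ! 0) y" for y
      by (simp add: signed_foot_def)
    moreover have "signed_foot (- e) (H ! 0) x \<le> 1/2" if "x \<in> curtain (H ! 0)" for x
      using that e(1) cat0_curtain_iff[OF cat0 k(1), of "- e" x] by simp
    ultimately show ?case
      using e(1) by (intro exI[of _ "- e"]) force
  next
    case (Suc i)
    let ?h = "H ! i" and ?k = "H ! (i + 1)"
    from Suc obtain e where e: "\<bar>e\<bar> = 1" "\<And>y. y \<in> curtain ?k \<Longrightarrow> 1/2 < signed_foot e ?h y"
      "\<And>x. x \<in> curtain (H ! 0) \<Longrightarrow> signed_foot e ?h x \<le> 1/2"
      "\<And>x y. x \<in> curtain (H ! 0) \<Longrightarrow> 1/2 < signed_foot e ?h y \<Longrightarrow> real i \<le> dist x y"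
      by auto
    have k: "is_curtain ?h" "is_curtain ?k"
      using Suc.prems cur by fastforce+
    have "separates ?k (curtain ?h) (curtain (H ! (i + 2)))"
      using H Suc.prems unfolding curtain_chain_def
      by (metis Suc_eq_plus1 add_Suc_right add_diff_cancel_right' one_add_one zero_less_Suc)
    then obtain f where f: "\<bar>f\<bar> = 1" "\<And>x. x \<in> curtain ?h \<Longrightarrow> signed_foot f ?k x < - 1/2"
      "\<And>x. x \<in> curtain (H ! (i + 2)) \<Longrightarrow> 1/2 < signed_foot f ?k x"
      using cat0_separatesE[OF cat0 k(2)] by metis
    let ?C = "{x. signed_foot e ?h x \<le> 1/2}"
    obtain z where z: "z \<in> curtain ?h" using centre_in_curtain[OF k(1)] by blast
    then have "z \<in> ?C"
      using cat0_curtain_iff[OF cat0 k(1) e(1), of z] by simp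
    have C: "?C \<inter> curtain ?k = {}"
      using e(2) by fastforce
    \<comment> \<open>Separation places a point of the curtain of \<open>?h\<close> on the negative
      side of \<open>?k\<close>; that point lies in \<open>?C\<close>, so all of \<open>?C\<close>
      is on this side.\<close>
    have far: "signed_foot f ?k x < - 1/2" if "x \<in> ?C" for x
      using cat0_connected_disjoint_curtain_side[OF cat0 k(2) f(1) cat0_connected_signed_foot_le[OF cat0 k(1) e(1)] C
          \<open>z \<in> ?C\<close> that] f(2)[OF z] by simp
    have "real (Suc i) \<le> dist x y" if x: "x \<in> curtain (H ! 0)" and y: "1/2 < signed_foot f ?k y" for x y
    proof -
      obtain S where S: "geodesic_segment x y S"
        by (rule cat0_geodesic_segment_exists[OF cat0])
      have "signed_foot f ?k x \<le> - 1/2"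
        using far e(3)[OF x] by fastforce
      \<comment> \<open>The entry into the curtain of \<open>?k\<close>: at \<open>z\<close> the
        previous half space has been left, which costs \<open>i\<close> by induction, and the
        curtain still to be crossed has width 1.\<close>
      then obtain z where z: "z \<in> S" "signed_foot f ?k z = - 1/2"
        using connected_real_ivt[OF geodesic_segment_connected[OF S] cat0_continuous_on_signed_foot[OF cat0 k(2)]
            geodesic_segment_endpoints[OF S], of f "- 1/2"] y by auto
      then have "z \<in> curtain ?k"
        using cat0_curtain_iff[OF cat0 k(2) f(1), of z] by simp
      then have "real i \<le> dist x z"
        using e(2,4) x by blast
      moreover have "1 \<le> dist z y"
        using cat0_signed_foot_lipschitz[OF cat0 k(2) f(1), of z y] z(2) y by linarith
      ultimately show ?thesis
        using geodesic_segment_between[OF S z(1)] by simp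
    qed
    moreover have "signed_foot f ?k x \<le> 1/2" if "x \<in> curtain (H ! 0)" for x
      using far e(3)[OF that] by fastforce
    ultimately show ?case
      using f by (intro exI[of _ f]; auto)
  }
qed

text \<open>The \<open>length H - 2\<close> intermediate curtains have width 1 each.\<close>

lemma cat0_curtain_chain_dist:
  fixes H :: "'a::metric_space curtain_data list"
  assumes cat0: "cat0_space TYPE('a)" and H: "curtain_chain H" "2 \<le> length H"
    and x: "x \<in> curtain (hd H)" and y: "y \<in> curtain (last H)"
  shows "real (length H) - 2 \<le> dist x y"
proof -
  have ne: "H \<noteq> []" using H by auto
  have "length H - 2 + 1 = length H - 1" "length H - 1 < length H" using H(2) by linarith+
  then have "real (length H - 2) \<le> dist x y"
    using cat0_curtain_chain_half_space[OF cat0 H(1), of "length H - 2"] x y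
    unfolding hd_conv_nth[OF ne] last_conv_nth[OF ne] by metis
  then show ?thesis
    using H(2) by simp
qed

text \<open>Names the constant hidden in \<open>Gromov_hyperbolic\<close>, so that explicit bounds
  can be stated.\<close>

definition slim_triangles :: "'a::metric_space itself \<Rightarrow> real \<Rightarrow> bool" where
  "slim_triangles _ d \<longleftrightarrow> 0 \<le> d \<and> (\<forall>(x::'a) y z A B C. geodesic_triangle x y z A B C \<longrightarrow>
     (\<forall>p\<in>A. \<exists>q\<in>B \<union> C. dist p q \<le> d))"

text \<open>A diagonal cuts the quadrilateral into two triangles, each contributing
  \<open>d\<close>.\<close>

lemma cat0_slim_quadrilateral:
  fixes x y z w :: "'a::metric_space"
  assumes cat0: "cat0_space TYPE('a)" and slim: "slim_triangles TYPE('a) d"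
    and A: "geodesic_segment x y A" and B: "geodesic_segment y z B"
    and C: "geodesic_segment z w C" and D: "geodesic_segment w x D" and p: "p \<in> A"
  obtains q where "q \<in> B \<union> C \<union> D" "dist p q \<le> 2 * d"
proof -
  obtain S where S: "geodesic_segment x z S"
    by (rule cat0_geodesic_segment_exists[OF cat0])
  have tri: "geodesic_triangle x y z A B S" "geodesic_triangle x z w S C D"
    using A B C D S geodesic_segment_commute[OF S] by (fastforce simp: geodesic_triangle_def)+
  obtain q where q: "q \<in> B \<union> S" "dist p q \<le> d"
    using slim tri(1) p unfolding slim_triangles_def by blast
  have d: "0 \<le> d" using slim by (simp add: slim_triangles_def)
  show ?thesis
  proof (cases "q \<in> B")
    case True
    then show ?thesis using that[of q] q d by simp
  next
    case False
    then have "q \<in> S" using q by blast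
    then obtain r where "r \<in> C \<union> D" "dist q r \<le> d"
      using slim tri(2) unfolding slim_triangles_def by blast
    then show ?thesis
      using that[of r] q dist_triangle[of p r q] by fastforce
  qed
qed

text \<open>The three sides through the closest points on the dual geodesic lie in the curtain.\<close>

lemma cat0_curtain_quasiconvex:
  fixes k :: "'a::metric_space curtain_data"
  assumes cat0: "cat0_space TYPE('a)" and slim: "slim_triangles TYPE('a) d"
    and k: "is_curtain k" and x: "x \<in> curtain k" and y: "y \<in> curtain k"
    and A: "geodesic_segment x y A" and p: "p \<in> A"
  obtains q where "q \<in> curtain k" "dist p q \<le> 2 * d"
proof -
  let ?f = "foot (dom k) (geod k)" and ?J = "{centre k - 1/2..centre k + 1/2}"
  have g: "geodesic (dom k) (geod k)" "dom k \<noteq> {}"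
    using is_curtain_geodesic[OF k] is_curtain_dom[OF k] by fastforce+
  have J: "?J \<subseteq> dom k" using k by (rule is_curtain_interval)
  have mem: "z \<in> curtain k \<longleftrightarrow> ?f z \<in> ?J" for z
    using cat0_curtain_proj_in_image_iff[OF cat0 k J, of z] by (simp add: curtain_def)
  \<comment> \<open>Feet are constant along a perpendicular, so it stays in the curtain.\<close>
  have side: "S \<subseteq> curtain k" if "geodesic_segment z (geod k (?f z)) S" "z \<in> curtain k" for z S
  proof
    fix w assume "w \<in> S"
    then have "?f w = ?f z"
      by (intro cat0_foot_eqI[OF cat0 g(1)] is_foot_between[OF is_foot_foot[OF g]]
          geodesic_segment_between[OF that(1)])
    then show "w \<in> curtain k" using that(2) mem by simp
  qed
  obtain D where D: "geodesic_segment x (geod k (?f x)) D"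
    by (rule cat0_geodesic_segment_exists[OF cat0])
  obtain B where B: "geodesic_segment y (geod k (?f y)) B"
    by (rule cat0_geodesic_segment_exists[OF cat0])
  let ?C = "geod k ` closed_segment (?f y) (?f x)"
  have fJ: "?f y \<in> ?J" "?f x \<in> ?J" using x y mem by fastforce+
  then have sub: "closed_segment (?f y) (?f x) \<subseteq> ?J"
    by (intro closed_segment_subset; auto)
  have C: "geodesic_segment (geod k (?f y)) (geod k (?f x)) ?C"
    using foot_in[OF g] by (intro geodesic_segment_subgeodesic[OF g(1)])
  have "?C \<subseteq> curtain k"
  proof
    fix w assume "w \<in> ?C"
    then obtain t where t: "t \<in> ?J" "w = geod k t" using sub by blast
    then have "?f w = t"
      using J by (intro cat0_foot_eqI[OF cat0 g(1)]; auto intro: is_foot_geodesic)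
    then show "w \<in> curtain k" using t mem by simp
  qed
  then have "B \<union> ?C \<union> D \<subseteq> curtain k"
    using side[OF D x] side[OF B y] by blast
  moreover obtain q where "q \<in> B \<union> ?C \<union> D" "dist p q \<le> 2 * d"
    by (rule cat0_slim_quadrilateral[OF cat0 slim A B C geodesic_segment_commute[OF D] p])
  ultimately show ?thesis
    using that by blast
qed

text \<open>Each point of a side running along the first curtain of \<open>H\<close> is near one of
  the end curtains of \<open>K\<close>. By connectedness some point is near both, although the
  length of \<open>K\<close> keeps them apart.\<close>

lemma cat0_hyperbolic_thin_grid:
  fixes H K :: "'a::metric_space curtain_data list"
  assumes cat0: "cat0_space TYPE('a)" and slim: "slim_triangles TYPE('a) d" and HK: "curtain_grid H K"
  shows "real (min (length H) (length K)) \<le> 8 * d + 4"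
proof (rule ccontr)
  assume "\<not> ?thesis"
  then have len: "8 * d + 4 < real (length H)" "8 * d + 4 < real (length K)" by fastforce+
  have d: "0 \<le> d" using slim by (simp add: slim_triangles_def)
  then have len2: "2 \<le> length H" "2 \<le> length K" using len by linarith+
  then have ne: "H \<noteq> []" "K \<noteq> []" by fastforce+
  have chain: "curtain_chain H" "curtain_chain K"
    and cross: "\<And>h k. h \<in> set H \<Longrightarrow> k \<in> set K \<Longrightarrow> curtain h \<inter> curtain k \<noteq> {}"
    using HK by (fastforce simp: curtain_grid_def)+
  let ?h = "curtain (hd H)" and ?h' = "curtain (last H)" and ?k = "curtain (hd K)" and ?k' = "curtain (last K)"
  have cur: "is_curtain (hd H)" "is_curtain (last H)" "is_curtain (hd K)" "is_curtain (last K)"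
    using chain ne by (fastforce simp: curtain_chain_def)+
  have distH: "8 * d + 2 < dist x y" if "x \<in> ?h" "y \<in> ?h'" for x y
    using cat0_curtain_chain_dist[OF cat0 chain(1) len2(1) that] len by simp
  have distK: "8 * d + 2 < dist x y" if "x \<in> ?k" "y \<in> ?k'" for x y
    using cat0_curtain_chain_dist[OF cat0 chain(2) len2(2) that] len by simp
  \<comment> \<open>The corners are ordered so that \<open>A\<close>, \<open>B\<close>,
    \<open>C\<close>, \<open>D\<close> have both ends in \<open>?h\<close>, \<open>?k'\<close>,
    \<open>?h'\<close>, \<open>?k\<close> respectively.\<close>
  obtain p q r s where pts: "p \<in> ?h" "p \<in> ?k" "q \<in> ?h" "q \<in> ?k'" "r \<in> ?h'" "r \<in> ?k'" "s \<in> ?h'" "s \<in> ?k"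
    using cross[of "hd H" "hd K"] cross[of "hd H" "last K"] cross[of "last H" "hd K"] cross[of "last H" "last K"] ne
    by auto
  obtain A B C D where seg: "geodesic_segment p q A" "geodesic_segment q r B"
    "geodesic_segment r s C" "geodesic_segment s p D"
    using cat0_geodesic_segment_exists[OF cat0] by metis
  \<comment> \<open>The bound is \<open>2 * d\<close> to another side plus \<open>2 * d\<close> from
    there to its curtain. The opposite side \<open>C\<close> is excluded, since it would bring
    \<open>?h\<close> within \<open>6 * d\<close> of \<open>?h'\<close>.\<close>
  have near: "infdist z ?k \<le> 4 * d \<or> infdist z ?k' \<le> 4 * d" if zA: "z \<in> A" for z
  proof -
    obtain z1 where z1: "z1 \<in> B \<union> C \<union> D" "dist z z1 \<le> 2 * d"
      by (rule cat0_slim_quadrilateral[OF cat0 slim seg zA])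
    have close: "infdist z S \<le> 4 * d" if "w \<in> S" "dist z1 w \<le> 2 * d" for w S
      using infdist_le[OF that(1), of z] that(2) z1(2) dist_triangle[of z w z1] by linarith
    show ?thesis
    proof (cases "z1 \<in> C")
      case True
      obtain u where u: "u \<in> ?h" "dist z u \<le> 2 * d"
        by (rule cat0_curtain_quasiconvex[OF cat0 slim cur(1) pts(1,3) seg(1) zA])
      obtain w where w: "w \<in> ?h'" "dist z1 w \<le> 2 * d"
        by (rule cat0_curtain_quasiconvex[OF cat0 slim cur(2) pts(5,7) seg(3) True])
      have "dist u w \<le> 6 * d"
        using u(2) w(2) z1(2) dist_triangle[of u w z] dist_triangle[of z w z1]
        by (simp add: dist_commute)
      then show ?thesis using distH[OF u(1) w(1)] d by linarith
    next
      case False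
      then consider "z1 \<in> B" | "z1 \<in> D" using z1 by blast
      then show ?thesis
      proof cases
        case 1
        obtain w where "w \<in> ?k'" "dist z1 w \<le> 2 * d"
          by (rule cat0_curtain_quasiconvex[OF cat0 slim cur(4) pts(4,6) seg(2) 1])
        then show ?thesis using close by blast
      next
        case 2
        obtain w where "w \<in> ?k" "dist z1 w \<le> 2 * d"
          by (rule cat0_curtain_quasiconvex[OF cat0 slim cur(3) pts(8,2) seg(4) 2])
        then show ?thesis using close by blast
      qed
    qed
  qed
  \<comment> \<open>The difference changes sign between \<open>p\<close> and \<open>q\<close>; where
    it vanishes, being near one end curtain means being near both.\<close>
  have "continuous_on A (\<lambda>z. infdist z ?k - infdist z ?k')"
    by (intro continuous_intros)
  moreover have "infdist p ?k - infdist p ?k' \<le> 0" "0 \<le> infdist q ?k - infdist q ?k'"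
    using pts infdist_nonneg by fastforce+
  ultimately obtain z where z: "z \<in> A" "infdist z ?k - infdist z ?k' = 0"
    by (rule connected_real_ivt[OF geodesic_segment_connected[OF seg(1)] _ geodesic_segment_endpoints[OF seg(1)]])
  \<comment> \<open>The infimum need not be attained, hence the extra 1. Two such distances add up
    to less than \<open>8 * d + 2\<close>.\<close>
  then have inf: "infdist z ?k < 4 * d + 1" "infdist z ?k' < 4 * d + 1"
    using near[OF z(1)] by fastforce+
  have "\<exists>w\<in>S. dist z w < 4 * d + 1" if "infdist z S < 4 * d + 1" "S \<noteq> {}" for S :: "'a set"
    using that cINF_less_iff[of S "dist z"] by (auto simp: infdist_def)
  from this[OF inf(1)] this[OF inf(2)]
  obtain u w where "u \<in> ?k" "dist z u < 4 * d + 1" "w \<in> ?k'" "dist z w < 4 * d + 1"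
    using pts(2,4) by blast
  then show False
    using distK[of u w] dist_triangle3[of u w z] by fastforce
qed

section \<open>Spaces with thin grids are hyperbolic\<close>

text \<open>Centres at odd integers leave gaps of length 1 between the dual intervals, and all of
  them lie in the interior of \<open>{0..t}\<close> once \<open>2 * n < t\<close>.\<close>

definition ladder :: "nat \<Rightarrow> real \<Rightarrow> (real \<Rightarrow> 'a::metric_space) \<Rightarrow> 'a curtain_data list" where
  "ladder n t b = map (\<lambda>i. Dual {0..t} b (2 * real i + 1)) [0..<n]"

lemma ladder_is_curtain:
  assumes "geodesic {0..t} b" "2 * real n < t" "i < n"
  shows "is_curtain (Dual {0..t} b (2 * real i + 1))"
proof -
  have "real i + 1 \<le> real n" using assms(3) by linarith
  then show ?thesis
    using assms by (auto simp: is_curtain_def interior_atLeastAtMost_real)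
qed

lemma cat0_ladder_chain:
  fixes b :: "real \<Rightarrow> 'a::metric_space"
  assumes cat0: "cat0_space TYPE('a)" and b: "geodesic {0..t} b" "2 * real n < t"
  shows "curtain_chain (ladder n t b)"
  unfolding curtain_chain_def
proof (intro conjI allI impI ballI)
  let ?k = "\<lambda>i. Dual {0..t} b (2 * real i + 1)"
  have cur: "is_curtain (?k i)" if "i < n" for i
    using ladder_is_curtain[OF b that] .
  have nth: "ladder n t b ! i = ?k i" if "i < n" for i
    using that by (simp add: ladder_def)
  have foot: "signed_foot 1 (?k i) x = foot {0..t} b x - (2 * real i + 1)" for i x
    by (simp add: signed_foot_def)
  have mem: "x \<in> curtain (?k i) \<longleftrightarrow> \<bar>foot {0..t} b x - (2 * real i + 1)\<bar> \<le> 1/2" if "i < n" for i x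
    using cat0_curtain_iff[OF cat0 cur[OF that], of 1 x] by (simp add: foot)
  show "is_curtain c" if "c \<in> set (ladder n t b)" for c
    using that cur by (auto simp: ladder_def)
  show "curtain (ladder n t b ! i) \<inter> curtain (ladder n t b ! j) = {}"
    if "i < length (ladder n t b)" "j < length (ladder n t b)" "i \<noteq> j" for i j
  proof -
    have "i < n" "j < n" using that by (fastforce simp: ladder_def)+
    moreover have "real i + 1 \<le> real j \<or> real j + 1 \<le> real i"
      using \<open>i \<noteq> j\<close> by linarith
    ultimately have "False" if "x \<in> curtain (?k i)" "x \<in> curtain (?k j)" for x
      using that mem[of i x] mem[of j x] by linarith
    then show ?thesis
      using \<open>i < n\<close> \<open>j < n\<close> by (auto simp: ladder_def)
  qed
  fix i assume i: "0 < i \<and> i + 1 < length (ladder n t b)"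
  then have i': "i - 1 < n" "i < n" "i + 1 < n" "real (i - 1) = real i - 1"
    by (fastforce simp: ladder_def)+
  then have "signed_foot 1 (?k i) x < - 1/2" if "x \<in> curtain (?k (i - 1))" for x
    using mem[of "i - 1" x] that unfolding foot by linarith
  moreover have "1/2 < signed_foot 1 (?k i) x" if "x \<in> curtain (?k (i + 1))" for x
    using that abs_ge_minus_self[of "foot {0..t} b x - (2 * real (i + 1) + 1)"]
    unfolding mem[OF i'(3)] foot by simp
  ultimately have "curtain (?k (i - 1)) \<subseteq> half_minus (?k i)" "curtain (?k (i + 1)) \<subseteq> half_plus (?k i)"
    unfolding subset_iff cat0_half_minus_iff[OF cat0 cur[OF i'(2)]]
      cat0_half_plus_iff[OF cat0 cur[OF i'(2)]]
    by blast+
  then have "separates (?k i) (curtain (?k (i - 1))) (curtain (?k (i + 1)))"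
    by (simp add: separates_def)
  then show "separates (ladder n t b ! i) (curtain (ladder n t b ! (i - 1))) (curtain (ladder n t b ! (i + 1)))"
    by (simp only: i'(1-3)[THEN nth])
qed

text \<open>Follow the pair of feet along the hypotenuse, a curve from \<open>(0, s)\<close> to \<open>(t, 0)\<close>.  If it
  avoids the square of side \<open>2n\<close> at the corner, then the first \<open>n\<close> curtains dual to either leg
  cross the first \<open>n\<close> dual to the other; if it visits the square, the corner is almost geodesic.\<close>

lemma cat0_right_angle_geodesics:
  fixes b c :: "real \<Rightarrow> 'a::metric_space"
  assumes cat0: "cat0_space TYPE('a)"
    and thin: "\<And>H K :: 'a curtain_data list. curtain_grid H K \<Longrightarrow> min (length H) (length K) < n"
    and b: "geodesic {0..t} b" "0 \<le> t" and c: "geodesic {0..s} c" "0 \<le> s" and bc: "b 0 = c 0"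
    and right: "is_foot {0..t} b (c s) 0"
  shows "s + t - 4 * real n \<le> dist (c s) (b t)"
proof -
  let ?u = "foot {0..s} c" and ?v = "foot {0..t} b"
  have ne: "{0..t} \<noteq> {}" "{0..s} \<noteq> {}" using b c by fastforce+
  have ends: "0 \<in> {0..t}" "t \<in> {0..t}" "0 \<in> {0..s}" "s \<in> {0..s}" using b c by fastforce+
  have vb: "?v (b r) = r" if "r \<in> {0..t}" for r
    using that by (intro cat0_foot_eqI[OF cat0 b(1)] is_foot_geodesic)
  \<comment> \<open>The whole leg \<open>c\<close> is perpendicular to \<open>b\<close>, being part
    of the perpendicular from \<open>c s\<close>.\<close>
  have vc: "is_foot {0..t} b (c r) 0" if r: "r \<in> {0..s}" for r
  proof (rule is_foot_between[OF right])
    show "dist (c s) (c r) + dist (c r) (b 0) = dist (c s) (b 0)"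
      using r ends by (simp add: bc geodesic_isometric[OF c(1)])
  qed
  \<comment> \<open>The right angle is symmetric: by Pythagoras, each \<open>c q\<close> is at
    distance at least \<open>r\<close> from \<open>b r\<close>, and \<open>r\<close> is the distance
    to the corner.\<close>
  have ub: "?u (b r) = 0" if r: "r \<in> {0..t}" for r
  proof (rule cat0_foot_eqI[OF cat0 c(1)])
    have "dist (b r) (c 0) \<le> dist (b r) (c q)" if "q \<in> {0..s}" for q
    proof -
      have "(dist (c q) (b 0))\<^sup>2 + (0 - r)\<^sup>2 \<le> (dist (c q) (b r))\<^sup>2"
        by (rule cat0_pythagoras[OF cat0 b(1) vc[OF that] r])
      then have "(dist (c q) (b 0))\<^sup>2 + r\<^sup>2 \<le> (dist (b r) (c q))\<^sup>2"
        by (simp add: dist_commute)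
      then have "r\<^sup>2 \<le> (dist (b r) (c q))\<^sup>2"
        using zero_le_power2[of "dist (c q) (b 0)"] by linarith
      then have "r \<le> dist (b r) (c q)"
        by (rule power2_le_imp_le) simp
      then show ?thesis
        using geodesic_isometric[OF b(1) r ends(1)] r by (simp add: bc[symmetric])
    qed
    then show "is_foot {0..s} c (b r) 0"
      using ends by (simp add: is_foot_def)
  qed
  have uc: "?u (c s) = s"
    using ends by (intro cat0_foot_eqI[OF cat0 c(1)] is_foot_geodesic)
  have vcs: "?v (c s) = 0"
    using vc ends by (intro cat0_foot_eqI[OF cat0 b(1)])
  have lip: "\<bar>?u x - ?u y\<bar> \<le> dist x y" "\<bar>?v x - ?v y\<bar> \<le> dist x y" for x y
    using cat0_foot_lipschitz[OF cat0 c(1) ne(2)] cat0_foot_lipschitz[OF cat0 b(1) ne(1)] by fastforce+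
  obtain S where S: "geodesic_segment (c s) (b t) S"
    by (rule cat0_geodesic_segment_exists[OF cat0])
  show ?thesis
  proof (cases "2 * real n < s \<and> 2 * real n < t")
    \<comment> \<open>Projecting to either leg shows that the hypotenuse is at least as long as both
      legs, and one leg is at most \<open>2 * n\<close>.\<close>
    case False
    then show ?thesis
      using lip(1)[of "c s" "b t"] lip(2)[of "c s" "b t"] uc vcs ub[OF ends(2)] vb[OF ends(2)] by linarith
  next
    case True
    have "\<exists>p\<in>S. ?u p < 2 * real n \<and> ?v p < 2 * real n"
    proof (rule ccontr)
      assume avoid: "\<not> ?thesis"
      have cross: "curtain (Dual {0..t} b (2 * real i + 1)) \<inter> curtain (Dual {0..s} c (2 * real j + 1)) \<noteq> {}"
        if "i < n" "j < n" for i j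
      proof -
        have ij: "2 * real i + 1 < 2 * real n" "2 * real j + 1 < 2 * real n"
          using that by linarith+
        obtain p where p: "p \<in> S" "?v p = 2 * real i + 1"
          using connected_real_ivt[OF geodesic_segment_connected[OF S]
              cat0_continuous_on_foot[OF cat0 b(1) ne(1)] geodesic_segment_endpoints[OF S], of "2 * real i + 1"]
            ij(1) True vcs vb[OF ends(2)] by auto
        have up: "2 * real n \<le> ?u p"
          using avoid p ij by force
        \<comment> \<open>Descend from \<open>p\<close> to the leg \<open>b\<close>. The foot on
          \<open>b\<close> stays at the centre of the chosen curtain, while the foot on
          \<open>c\<close> goes from at least \<open>2 * n\<close> to 0 and meets the other
          centre.\<close>
        obtain T where T: "geodesic_segment (b (?v p)) p T"
          by (rule cat0_geodesic_segment_exists[OF cat0])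
        have "?u (b (?v p)) = 0"
          by (rule ub) (rule foot_in[OF b(1) ne(1)])
        then obtain q where q: "q \<in> T" "?u q = 2 * real j + 1"
          using connected_real_ivt[OF geodesic_segment_connected[OF T]
              cat0_continuous_on_foot[OF cat0 c(1) ne(2)] geodesic_segment_endpoints[OF T], of "2 * real j + 1"]
            ij(2) up by auto
        have "?v q = ?v p"
          by (intro cat0_foot_eqI[OF cat0 b(1)] is_foot_between[OF is_foot_foot[OF b(1) ne(1)]]
              geodesic_segment_between[OF geodesic_segment_commute[OF T] q(1)])
        then have "q \<in> curtain (Dual {0..t} b (2 * real i + 1))"
          using cat0_curtain_iff[OF cat0 ladder_is_curtain[OF b(1) _ that(1)], of 1 q] True p(2)
          by (simp add: signed_foot_def)
        moreover have "q \<in> curtain (Dual {0..s} c (2 * real j + 1))"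
          using cat0_curtain_iff[OF cat0 ladder_is_curtain[OF c(1) _ that(2)], of 1 q] True q(2)
          by (simp add: signed_foot_def)
        ultimately show ?thesis by blast
      qed
      then have "\<forall>h\<in>set (ladder n t b). \<forall>k\<in>set (ladder n s c). curtain h \<inter> curtain k \<noteq> {}"
        unfolding ladder_def by simp
      then have "curtain_grid (ladder n t b) (ladder n s c)"
        using True by (simp add: curtain_grid_def cat0_ladder_chain[OF cat0 b(1)] cat0_ladder_chain[OF cat0 c(1)])
      then show False
        using thin[of "ladder n t b" "ladder n s c"] by (simp add: ladder_def)
    qed
    then obtain p where p: "p \<in> S" "?u p < 2 * real n" "?v p < 2 * real n" by blast
    \<comment> \<open>The projection bounds give at least \<open>s - 2 * n\<close> before
      \<open>p\<close> and \<open>t - 2 * n\<close> after it.\<close>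
    then show ?thesis
      using lip(1)[of "c s" p] lip(2)[of p "b t"] uc vb[OF ends(2)] geodesic_segment_between[OF S p(1)] by linarith
  qed
qed

text \<open>Being closest to \<open>z\<close> on all of \<open>S\<close>, the point \<open>q\<close>
  is also closest on the part from \<open>q\<close> to \<open>y\<close>; this part and
  \<open>[q, z]\<close> are the two legs.\<close>

lemma cat0_thin_grids_right_angle:
  fixes x y z :: "'a::metric_space"
  assumes cat0: "cat0_space TYPE('a)"
    and thin: "\<And>H K :: 'a curtain_data list. curtain_grid H K \<Longrightarrow> min (length H) (length K) < n"
    and S: "geodesic_segment x y S" "q \<in> S" "\<And>p. p \<in> S \<Longrightarrow> dist z q \<le> dist z p"
  shows "dist z q + dist q y - 4 * real n \<le> dist z y"
proof -
  obtain T where T: "T \<subseteq> S" "geodesic_segment q y T"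
    using geodesic_segment_subsegment[OF S(1,2)] by metis
  from T(2) obtain b where b: "geodesic {0..dist q y} b" "b 0 = q" "b (dist q y) = y" "T = b ` {0..dist q y}"
    by (rule geodesic_segmentE)
  obtain R where "geodesic_segment q z R"
    by (rule cat0_geodesic_segment_exists[OF cat0])
  then obtain c where c: "geodesic {0..dist q z} c" "c 0 = q" "c (dist q z) = z"
    by (rule geodesic_segmentE)
  have "is_foot {0..dist q y} b (c (dist q z)) 0"
    using b c S(3) T(1) by (auto simp: is_foot_def)
  then show ?thesis
    using cat0_right_angle_geodesics[OF cat0 thin b(1) _ c(1)] b c by (simp add: dist_commute)
qed

lemma cat0_thin_grids_slim:
  fixes x y z :: "'a::metric_space"
  assumes cat0: "cat0_space TYPE('a)"
    and thin: "\<And>H K :: 'a curtain_data list. curtain_grid H K \<Longrightarrow> min (length H) (length K) < n"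
    and tri: "geodesic_triangle x y z A B C" and p: "p \<in> A"
  obtains w where "w \<in> B \<union> C" "dist p w \<le> 6 * real n"
proof -
  note right = cat0_thin_grids_right_angle[OF cat0 thin]
  have seg: "geodesic_segment x y A" "geodesic_segment y z B" "geodesic_segment z x C"
    using tri by (auto simp: geodesic_triangle_def)
  obtain q where q: "q \<in> A" "\<And>p. p \<in> A \<Longrightarrow> dist z q \<le> dist z p"
    using nearest_on_geodesic_segment[OF seg(1)] by metis
  \<comment> \<open>One claim for both halves of \<open>A\<close>: \<open>e\<close> stands for the
    end beyond \<open>p\<close>, and \<open>D\<close> for the side from \<open>z\<close> to
    \<open>e\<close>.\<close>
  have side: "\<exists>w\<in>D. dist p w \<le> 6 * real n"
    if D: "geodesic_segment z e D" and pe: "dist q p + dist p e = dist q e"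
      and qe: "dist z q + dist q e - 4 * real n \<le> dist z e" for e D
  proof -
    obtain w where w: "w \<in> D" "\<And>r. r \<in> D \<Longrightarrow> dist p w \<le> dist p r"
      using nearest_on_geodesic_segment[OF D] by metis
    have "dist p w + dist w e - 4 * real n \<le> dist p e"
      by (rule right[OF _ D w])
    moreover have "dist p w + dist w z - 4 * real n \<le> dist p z"
      by (rule right[OF _ geodesic_segment_commute[OF D] w])
    moreover have "dist z w + dist w e = dist z e"
      by (rule geodesic_segment_between[OF D w(1)])
    \<comment> \<open>The sum of the two bounds at \<open>w\<close> is
      \<open>2 * d(p, w) + d(z, e) - 8 * n <= d(p, e) + d(p, z)\<close>. The right side is at most
      \<open>d(z, q) + d(q, e)\<close>, hence at most \<open>d(z, e) + 4 * n\<close>.\<close>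
    ultimately have "dist p w \<le> 6 * real n"
      using pe qe dist_triangle[of z p q] by (simp add: dist_commute)
    then show ?thesis using w by blast
  qed
  from geodesic_segment_trichotomy[OF seg(1) p q(1)] show ?thesis
  proof
    assume *: "dist q p + dist p x = dist q x"
    have "dist z q + dist q x - 4 * real n \<le> dist z x"
      by (rule right[OF _ geodesic_segment_commute[OF seg(1)] q])
    then show ?thesis
      using side[OF seg(3) *] that by blast
  next
    assume *: "dist q p + dist p y = dist q y"
    have "dist z q + dist q y - 4 * real n \<le> dist z y"
      by (rule right[OF _ seg(1) q])
    then show ?thesis
      using side[OF geodesic_segment_commute[OF seg(2)] *] that by blast
  qed
qed

theorem theoremE:
  assumes "cat0_space TYPE('a::metric_space)"
  shows "Gromov_hyperbolic TYPE('a) \<longleftrightarrow>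
    (\<exists>E::real. E > 0 \<and> (\<forall>H K :: 'a curtain_data list. curtain_grid H K \<longrightarrow> thin_grid E H K))"
proof
  \<comment> \<open>The curtains of a chain are distinct as sets, so thinness is a condition on
    lengths.\<close>
  have thin_iff: "thin_grid E H K \<longleftrightarrow> real (min (length H) (length K)) \<le> E"
    if "curtain_grid H K" for E and H K :: "'a curtain_data list"
    using that by (simp add: thin_grid_def curtain_grid_def card_curtain_chain)
  show "\<exists>E>0. \<forall>H K :: 'a curtain_data list. curtain_grid H K \<longrightarrow> thin_grid E H K"
    if "Gromov_hyperbolic TYPE('a)"
  proof -
    from that obtain d where "slim_triangles TYPE('a) d"
      unfolding Gromov_hyperbolic_def slim_triangles_def by blast
    then show ?thesis
      using cat0_hyperbolic_thin_grid[OF assms] thin_iff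
      by (intro exI[of _ "8 * d + 4"]; auto simp: slim_triangles_def)
  qed
  assume "\<exists>E>0. \<forall>H K :: 'a curtain_data list. curtain_grid H K \<longrightarrow> thin_grid E H K"
  then obtain E where E: "E > 0" "\<And>H K :: 'a curtain_data list. curtain_grid H K \<Longrightarrow> thin_grid E H K"
    by blast
  \<comment> \<open>A natural number strictly above \<open>E\<close>, so that no grid has two chains
    of length \<open>n\<close>.\<close>
  define n where "n = nat \<lfloor>E\<rfloor> + 1"
  have "min (length H) (length K) < n" if "curtain_grid H K" for H K :: "'a curtain_data list"
    using E(2)[OF that, unfolded thin_iff[OF that]] unfolding n_def by linarith
  note slim = cat0_thin_grids_slim[OF assms this]
  have "geodesic_space TYPE('a)"
    using assms by (simp add: cat0_space_def)
  moreover have "\<forall>(x::'a) y z A B C. geodesic_triangle x y z A B C \<longrightarrow>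
      (\<forall>p\<in>A. \<exists>w\<in>B \<union> C. dist p w \<le> 6 * real n)"
    by (meson slim)
  ultimately show "Gromov_hyperbolic TYPE('a)"
    unfolding Gromov_hyperbolic_def by (intro conjI exI[of _ "6 * real n"]; auto)
qed

end
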